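(* Consider the problem $\min_{x\in\mathcal X} f(x)$, $f=\frac1n\sum_{i=1}^n f_i$, where $\mathcal X\subset\mathbb R^d$ is nonempty, convex and compact with $\|x-y\|\le D$ for all $x,y\in\mathcal X$; $f$ is $L$-smooth on $\mathcal X$; and each $f_i$ is $L_i$-smooth on $\mathcal X$ (neither $f$ nor the $f_i$ are assumed convex). Let $\tilde L^2=\frac1n\sum_{i=1}^n L_i^2$ and let $x^*$ be a global (possibly non-unique) minimizer of $f$ on $\mathcal X$. Let $\{x^k\}$ be the iterates of the Sarah Frank-Wolfe algorithm (described in the context) with probability $p\in(0,1]$, batch size $b$, and step sizes $\eta_k=\frac1{\sqrt K}$ for $0\le k\le K-1$, where $K\ge1$ is the number of iterations. Then $$\mathbb E\left[\min_{0\le k\le K-1}\operatorname{gap}(x^k)\right]=\mathcal O\left(\frac{f(x^0)-f(x^* )}{\sqrt K}+\frac{LD^2}{\sqrt K}\left[1+\frac{\tilde L}{L}\sqrt{\frac{1-p}{pb}}\right]\right),$$ where $\operatorname{gap}(y)=\max_{x\in\mathcal X}\langle\nabla f(y),y-x\rangle$ and $\mathcal O(\cdot)$ hides an absolute numerical constant.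
   Context: Norms and inner products are Euclidean and $[n]=\{1,\dots,n\}$. The $f_i$ are real-valued and differentiable on $\mathcal X$ (say, on an open neighbourhood of $\mathcal X$). A function $h$ is $M$-smooth on $\mathcal X$ ($M>0$) if $\|\nabla h(x)-\nabla h(y)\|\le M\|x-y\|$ for all $x,y\in\mathcal X$. The constants satisfy $L,L_i,D>0$. Sarah Frank-Wolfe algorithm. Parameters: step sizes $\{\eta_k\}$, probability $p$, integer batch size $b$ with $1\le b\le n$. Initialization: $x^0\in\mathcal X$ (deterministic), $g^0=\nabla f(x^0)$. For $k=0,1,\dots,K-1$: (1) $s^k\in\arg\min_{s\in\mathcal X}\langle g^k,s\rangle$ (any minimizer, chosen as a measurable function of the past); (2) $x^{k+1}=x^k+\eta_k(s^k-x^k)$; (3) draw a batch $S_k$ of $b$ indices uniformly at random from $[n]$ (i.i.d., with repetitions counted in sums over $S_k$), independent of the past; (4) with probability $p$ (independently of everything else) set $g^{k+1}=\nabla f(x^{k+1})$; otherwise, with probability $1-p$, set $g^{k+1}=g^k+\frac1b\sum_{i\in S_k}[\nabla f_i(x^{k+1})-\nabla f_i(x^k)]$. The statement "$A=\mathcal O(B)$" means $A\le C\,B$ for an absolute constant $C$ independent of the problem instance, $n,d,p,b,K$ and $x^0$. *)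

theory Defs
  imports "HOL-Probability.Probability"
begin

definition grad :: "('a::real_inner \<Rightarrow> real) \<Rightarrow> 'a \<Rightarrow> 'a" where
  "grad h x = (THE v. GDERIV h x :> v)"

(* Differentiability of h is assumed separately wherever this is used. *)
definition smooth_on :: "real \<Rightarrow> ('a::real_inner \<Rightarrow> real) \<Rightarrow> 'a set \<Rightarrow> bool" where
  "smooth_on B h X \<longleftrightarrow> B > 0 \<and> (\<forall>x\<in>X. \<forall>y\<in>X. norm (grad h x - grad h y) \<le> B * norm (x - y))"

definition average :: "nat \<Rightarrow> (nat \<Rightarrow> 'a \<Rightarrow> real) \<Rightarrow> 'a \<Rightarrow> real" where
  "average n f x = (1 / real n) * (\<Sum>i=1..n. f i x)"

(* On a nonempty compact X the supremum is attained, i.e. it is the maximum. *)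
definition fw_gap :: "('a::real_inner \<Rightarrow> real) \<Rightarrow> 'a set \<Rightarrow> 'a \<Rightarrow> real" where
  "fw_gap h X y = (SUP x\<in>X. inner (grad h y) (y - x))"

(* The sigma-algebra generated by the discrete random variables Z 0, ..., Z (k - 1). *)
definition past :: "'w measure \<Rightarrow> (nat \<Rightarrow> 'w \<Rightarrow> 'b) \<Rightarrow> nat \<Rightarrow> 'w measure" where
  "past M Z k = sigma (space M) (\<Union>j<k. sets (vimage_algebra (space M) (Z j) (count_space UNIV)))"

(* A run of length K.  S k is the batch drawn at step k, as a list of b indices in which
   repetitions are allowed, and c k is the coin, where True selects the full gradient.
   The initial point is deterministic and every later quantity is determined by the draws and
   the minimizers s k, so the past of step k is the one generated by the draws before step k. *)
locale sarah_frank_wolfe = prob_space M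
  for M :: "'w measure" +
  fixes X :: "(real ^ 'd) set"
    and n :: nat
    and f :: "nat \<Rightarrow> real ^ 'd \<Rightarrow> real"
    and x0 :: "real ^ 'd"
    and \<eta> :: "nat \<Rightarrow> real"
    and p :: real
    and b :: nat
    and K :: nat
    and S :: "nat \<Rightarrow> 'w \<Rightarrow> nat list"
    and c :: "nat \<Rightarrow> 'w \<Rightarrow> bool"
    and s x g :: "nat \<Rightarrow> 'w \<Rightarrow> real ^ 'd"
  assumes init_in: "x0 \<in> X"
    and x_init: "\<And>\<omega>. \<omega> \<in> space M \<Longrightarrow> x 0 \<omega> = x0"
    and g_init: "\<And>\<omega>. \<omega> \<in> space M \<Longrightarrow> g 0 \<omega> = grad (average n f) x0"
    and s_argmin: "\<And>k \<omega>. k < K \<Longrightarrow> \<omega> \<in> space M \<Longrightarrow>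
          is_arg_min (\<lambda>v. inner (g k \<omega>) v) (\<lambda>v. v \<in> X) (s k \<omega>)"
    and s_measurable: "\<And>k. k < K \<Longrightarrow>
          s k \<in> borel_measurable (past M (\<lambda>j \<omega>. (S j \<omega>, c j \<omega>)) k)"
    and x_step: "\<And>k \<omega>. k < K \<Longrightarrow> \<omega> \<in> space M \<Longrightarrow>
          x (Suc k) \<omega> = x k \<omega> + \<eta> k *\<^sub>R (s k \<omega> - x k \<omega>)"
    and draw_measurable: "\<And>k. k < K \<Longrightarrow>
          (\<lambda>\<omega>. (S k \<omega>, c k \<omega>)) \<in> measurable M (count_space UNIV)"
    and draw_distr: "\<And>k. k < K \<Longrightarrow>
          distr M (count_space UNIV) (\<lambda>\<omega>. (S k \<omega>, c k \<omega>)) =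
            measure_pmf (pair_pmf (replicate_pmf b (pmf_of_set {1..n})) (bernoulli_pmf p))"
    and draw_indep_past: "\<And>k. k < K \<Longrightarrow>
          indep_set (sets (past M (\<lambda>j \<omega>. (S j \<omega>, c j \<omega>)) k))
            (sets (vimage_algebra (space M) (\<lambda>\<omega>. (S k \<omega>, c k \<omega>)) (count_space UNIV)))"
    and g_step: "\<And>k \<omega>. k < K \<Longrightarrow> \<omega> \<in> space M \<Longrightarrow>
          g (Suc k) \<omega> =
            (if c k \<omega> then grad (average n f) (x (Suc k) \<omega>)
             else g k \<omega> + (1 / real b) *\<^sub>R
               (\<Sum>i\<leftarrow>S k \<omega>. grad (f i) (x (Suc k) \<omega>) - grad (f i) (x k \<omega>)))"

(* The constant hidden by the O-notation.  An existentially quantified constant inside a theorem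
   could depend on the type variables of that theorem, that is on the dimension d and on the
   probability space.  A closed real number is uniform in them. *)
definition abs_const :: real where
  "abs_const = 1"

end

theory Submission
  imports Defs
begin

text \<open>
  Write \<open>F\<close> for the average of the \<open>f i\<close> and \<open>e\<^sub>k = \<parallel>g\<^sub>k - \<nabla>F(x\<^sub>k)\<parallel>\<close> for the error of the estimator.

  A step of size \<open>t\<close> in the direction that is optimal for \<open>g\<^sub>k\<close> satisfies, for every outcome,
  \<open>t * gap(x\<^sub>k) \<le> F(x\<^sub>k) - F(x\<^sub>k\<^sub>+\<^sub>1) + t * D * e\<^sub>k + L * t\<^sup>2 * D\<^sup>2\<close> (lemma \<open>fw_step\<close>).  For
  \<open>t = 1 / sqrt K\<close>, summing over \<open>k < K\<close> and bounding the minimal gap by the average one gives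
  \<open>min gap \<le> (F(x\<^sub>0) - F(x\<^sup>*) + L * D\<^sup>2) / sqrt K + (D / K) * (\<Sum>k<K. e\<^sub>k)\<close>.

  It remains to bound the mean of \<open>e\<^sub>k\<close>, and by the Cauchy-Schwarz inequality its second moment
  \<open>E\<^sub>k\<close>.  With probability \<open>p\<close> the error is reset to zero; otherwise an unbiased estimate of the
  gradient increment is added, whose variance is at most \<open>C = Ltilde\<^sup>2 * t\<^sup>2 * D\<^sup>2 / b\<close> because one step
  moves by at most \<open>t * D\<close>.  Hence \<open>E\<^sub>k\<^sub>+\<^sub>1 \<le> (1 - p) * (E\<^sub>k + C)\<close> (lemma \<open>estimator_error_step\<close>),
  and since \<open>E\<^sub>0 = 0\<close>, this gives \<open>E\<^sub>k \<le> (1 - p) * C / p\<close> (lemma \<open>estimator_error_bound\<close>).  All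
  constants add up to the bound with factor one.

  The recursion conditions on the past of step \<open>k\<close>.  As the draws are discrete, a function that is
  measurable with respect to the past is a function of the list of earlier draws, the history.  The
  draw of step \<open>k\<close> is independent of the history, so conditioning amounts to integrating over the
  draw with the history held fixed (lemma \<open>nn_integral_indep_discrete\<close>).
\<close>

section \<open>Gradients and the descent estimate of one step\<close>

lemma GDERIV_unique:
  fixes h :: "'a::real_inner \<Rightarrow> real"
  assumes "GDERIV h x :> u" "GDERIV h x :> v"
  shows "u = v"
proof -
  have "(\<lambda>w. inner w u) = (\<lambda>w. inner w v)"
    using assms unfolding gderiv_def by (rule has_derivative_unique)
  then show ?thesis
    by (metis inner_commute vector_eq_rdot)
qed

lemma grad_eqI: "GDERIV h x :> v \<Longrightarrow> grad h x = v"
  unfolding grad_def by (rule the_equality, assumption, rule GDERIV_unique)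

lemma differentiable_imp_GDERIV_grad:
  fixes h :: "'a::euclidean_space \<Rightarrow> real"
  assumes "h differentiable (at x)"
  shows "GDERIV h x :> grad h x"
proof -
  obtain h' where h': "(h has_derivative h') (at x)"
    using assms unfolding differentiable_def by blast
  then interpret linear h'
    by (rule has_derivative_linear)
  have "h' w = inner w (\<Sum>e\<in>Basis. h' e *\<^sub>R e)" for w
  proof -
    have "h' w = h' (\<Sum>e\<in>Basis. inner w e *\<^sub>R e)"
      by (simp add: euclidean_representation)
    also have "\<dots> = (\<Sum>e\<in>Basis. inner w e * h' e)"
      by (simp add: sum scale)
    finally show ?thesis
      by (simp add: inner_sum_right mult.commute)
  qed
  then have "h' = (\<lambda>w. inner w (\<Sum>e\<in>Basis. h' e *\<^sub>R e))"
    by (rule ext)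
  with h' have "GDERIV h x :> (\<Sum>e\<in>Basis. h' e *\<^sub>R e)"
    unfolding gderiv_def by metis
  then show ?thesis
    using grad_eqI by metis
qed

lemma GDERIV_average:
  fixes f :: "nat \<Rightarrow> 'a::real_inner \<Rightarrow> real"
  assumes "\<And>i. i \<in> {1..n} \<Longrightarrow> GDERIV (f i) x :> v i"
  shows "GDERIV (average n f) x :> (1 / real n) *\<^sub>R (\<Sum>i=1..n. v i)"
proof -
  have "(average n f has_derivative (\<lambda>w. (1 / real n) * (\<Sum>i=1..n. inner w (v i)))) (at x)"
    unfolding average_def[abs_def]
    by (intro has_derivative_mult_right has_derivative_sum) (use assms in \<open>simp add: gderiv_def\<close>)
  then show ?thesis
    by (simp add: gderiv_def inner_sum_right)
qed

text \<open>The mean value theorem gives the quadratic upper bound with the constant \<open>B\<close> rather than the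
  optimal \<open>B / 2\<close>; this is all that is needed below.\<close>

lemma smooth_on_upper_bound:
  fixes h :: "'a::real_inner \<Rightarrow> real"
  assumes "convex X" and h': "\<And>y. y \<in> X \<Longrightarrow> GDERIV h y :> grad h y" and "smooth_on B h X"
    and "u \<in> X" "v \<in> X"
  shows "h v \<le> h u + inner (grad h u) (v - u) + B * (norm (v - u))\<^sup>2"
proof -
  define \<gamma> where "\<gamma> t = u + t *\<^sub>R (v - u)" for t :: real
  have \<gamma>_in: "\<gamma> t \<in> X" if "0 \<le> t" "t \<le> 1" for t
  proof -
    have "\<gamma> t = (1 - t) *\<^sub>R u + t *\<^sub>R v"
      by (simp add: \<gamma>_def algebra_simps)
    then show ?thesis
      using convexD_alt[OF assms(1,4,5) that] by simp
  qed
  have "((\<lambda>t. h (\<gamma> t)) has_derivative (\<lambda>r. inner (r *\<^sub>R (v - u)) (grad h (\<gamma> t))))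
      (at t within {0..1})" if "0 \<le> t" "t \<le> 1" for t
  proof -
    have "(\<gamma> has_derivative (\<lambda>r. r *\<^sub>R (v - u))) (at t within {0..1})"
      unfolding \<gamma>_def[abs_def] by (auto intro!: derivative_eq_intros)
    moreover have "(h has_derivative (\<lambda>w. inner w (grad h (\<gamma> t)))) (at (\<gamma> t))"
      using h'[OF \<gamma>_in[OF that]] by (simp add: gderiv_def)
    ultimately show ?thesis
      by (rule has_derivative_compose)
  qed
  from mvt_simple[OF zero_less_one this] obtain t where t: "0 < t" "t < 1"
      and "h (\<gamma> 1) - h (\<gamma> 0) = inner ((1 - 0) *\<^sub>R (v - u)) (grad h (\<gamma> t))"
    by auto
  then have "h v - h u = inner (grad h u) (v - u) + inner (v - u) (grad h (\<gamma> t) - grad h u)"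
    by (simp add: \<gamma>_def inner_diff_right inner_commute)
  moreover have "inner (v - u) (grad h (\<gamma> t) - grad h u) \<le> B * (norm (v - u))\<^sup>2"
  proof -
    have "B > 0" using assms(3) by (simp add: smooth_on_def)
    have "inner (v - u) (grad h (\<gamma> t) - grad h u)
        \<le> norm (v - u) * norm (grad h (\<gamma> t) - grad h u)"
      by (rule norm_cauchy_schwarz)
    also have "\<dots> \<le> norm (v - u) * (B * norm (\<gamma> t - u))"
      using assms(3,4) \<gamma>_in t by (intro mult_left_mono) (auto simp: smooth_on_def)
    also have "\<dots> \<le> norm (v - u) * (B * norm (v - u))"
      using t \<open>B > 0\<close> by (intro mult_left_mono) (auto simp: \<gamma>_def mult_left_le_one_le)
    finally show ?thesis
      by (simp add: power2_eq_square algebra_simps)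
  qed
  ultimately show ?thesis by simp
qed

lemma inner_grad_diff_le:
  fixes h :: "'a::real_inner \<Rightarrow> real"
  assumes "\<And>u v. u \<in> X \<Longrightarrow> v \<in> X \<Longrightarrow> norm (u - v) \<le> D" and "y \<in> X" and "v \<in> X"
  shows "inner (grad h y) (y - v) \<le> norm (grad h y) * D"
  using norm_cauchy_schwarz mult_left_mono[OF assms(1)[OF assms(2,3)] norm_ge_zero]
  by (rule order_trans)

lemma fw_gap_bounds:
  fixes h :: "'a::real_inner \<Rightarrow> real"
  assumes "\<And>u v. u \<in> X \<Longrightarrow> v \<in> X \<Longrightarrow> norm (u - v) \<le> D" and "y \<in> X"
  shows "0 \<le> fw_gap h X y" and "fw_gap h X y \<le> norm (grad h y) * D"
proof -
  have "bdd_above ((\<lambda>v. inner (grad h y) (y - v)) ` X)"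
    using inner_grad_diff_le[OF assms] by (intro bdd_aboveI2)
  from cSUP_upper[OF assms(2) this] show "0 \<le> fw_gap h X y"
    by (simp add: fw_gap_def)
  show "fw_gap h X y \<le> norm (grad h y) * D"
    unfolding fw_gap_def using assms inner_grad_diff_le[OF assms] by (intro cSUP_least) auto
qed

text \<open>The direction \<open>s\<close> minimises the linear form of an estimate \<open>g\<close> of the gradient, so it competes
  with every \<open>v \<in> X\<close> up to the error \<open>\<langle>\<nabla>h(y) - g, s - v\<rangle>\<close>, which is where the diameter enters.\<close>

lemma fw_step:
  fixes h :: "'a::real_inner \<Rightarrow> real"
  assumes "convex X" and "\<And>y. y \<in> X \<Longrightarrow> GDERIV h y :> grad h y" and "smooth_on B h X"
    and diam: "\<And>u v. u \<in> X \<Longrightarrow> v \<in> X \<Longrightarrow> norm (u - v) \<le> D"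
    and "y \<in> X" and s: "is_arg_min (inner g) (\<lambda>v. v \<in> X) s" and t: "0 \<le> t" "t \<le> 1"
  shows "t * fw_gap h X y
    \<le> h y - h (y + t *\<^sub>R (s - y)) + t * D * norm (g - grad h y) + B * t\<^sup>2 * D\<^sup>2"
proof -
  have "s \<in> X" using s by (simp add: is_arg_min_def)
  have "inner (grad h y) (y - v) \<le> inner (grad h y) (y - s) + norm (g - grad h y) * D"
    if "v \<in> X" for v
  proof -
    have "inner g s \<le> inner g v"
      using s that by (auto simp: is_arg_min_def not_less)
    then have "inner (grad h y) (y - v) - inner (grad h y) (y - s)
        \<le> inner (g - grad h y) (v - s)"
      by (simp add: inner_diff_left inner_diff_right)
    also have "\<dots> \<le> norm (g - grad h y) * norm (v - s)"
      by (rule norm_cauchy_schwarz)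
    also have "\<dots> \<le> norm (g - grad h y) * D"
      using diam \<open>s \<in> X\<close> that by (intro mult_left_mono) auto
    finally show ?thesis by simp
  qed
  then have "fw_gap h X y \<le> inner (grad h y) (y - s) + norm (g - grad h y) * D"
    unfolding fw_gap_def using \<open>y \<in> X\<close> by (intro cSUP_least) auto
  from mult_left_mono[OF this t(1)]
  have gap: "t * fw_gap h X y
      \<le> - inner (grad h y) (t *\<^sub>R (s - y)) + t * D * norm (g - grad h y)"
    by (simp add: algebra_simps inner_diff_right)
  have "y + t *\<^sub>R (s - y) = (1 - t) *\<^sub>R y + t *\<^sub>R s"
    by (simp add: algebra_simps)
  then have "y + t *\<^sub>R (s - y) \<in> X"
    using convexD_alt[OF \<open>convex X\<close> \<open>y \<in> X\<close> \<open>s \<in> X\<close> t] by simp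
  from smooth_on_upper_bound[OF assms(1-3) \<open>y \<in> X\<close> this]
  have "h (y + t *\<^sub>R (s - y))
      \<le> h y + inner (grad h y) (t *\<^sub>R (s - y)) + B * (t\<^sup>2 * (norm (s - y))\<^sup>2)"
    by (simp add: power_mult_distrib)
  also have "B * (t\<^sup>2 * (norm (s - y))\<^sup>2) \<le> B * (t\<^sup>2 * D\<^sup>2)"
    using assms(3) diam[OF \<open>s \<in> X\<close> \<open>y \<in> X\<close>]
    by (intro mult_left_mono power_mono) (auto simp: smooth_on_def)
  finally show ?thesis using gap by simp
qed

section \<open>The second moment of a batch sum\<close>

text \<open>Adding a batch of \<open>b\<close> independent uniform samples of \<open>u\<close> to a fixed vector \<open>a\<close> shifts it by \<open>b\<close>
  times the mean \<open>m\<close>, up to a variance of at most \<open>b\<close> times the second moment \<open>V\<close>.  In the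
  induction over \<open>b\<close>, the first sample \<open>u i\<close> is absorbed into the start \<open>a\<close>.\<close>

lemma nn_integral_batch_le:
  fixes u :: "nat \<Rightarrow> 'a::real_inner" and a :: 'a
  assumes "n \<ge> 1"
  defines "m \<equiv> (1 / real n) *\<^sub>R (\<Sum>i=1..n. u i)"
    and "V \<equiv> (1 / real n) * (\<Sum>i=1..n. (norm (u i))\<^sup>2)"
  shows "(\<integral>\<^sup>+l. ennreal ((norm (a + (\<Sum>i\<leftarrow>l. u i)))\<^sup>2)
      \<partial>measure_pmf (replicate_pmf b (pmf_of_set {1..n})))
    \<le> ennreal ((norm (a + real b *\<^sub>R m))\<^sup>2 + real b * V)"
proof (induction b arbitrary: a)
  case 0
  show ?case by simp
next
  case (Suc b)
  define e where "e = a + real b *\<^sub>R m"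
  have V: "V \<ge> 0" by (simp add: V_def sum_nonneg)
  have sum_u: "(\<Sum>i=1..n. u i) = real n *\<^sub>R m" "(\<Sum>i=1..n. (norm (u i))\<^sup>2) = real n * V"
    using assms(1) by (simp_all add: m_def V_def)
  have "(\<integral>\<^sup>+l. ennreal ((norm (a + (\<Sum>i\<leftarrow>l. u i)))\<^sup>2)
      \<partial>measure_pmf (replicate_pmf (Suc b) (pmf_of_set {1..n})))
    = (\<integral>\<^sup>+i. (\<integral>\<^sup>+l. ennreal ((norm ((a + u i) + (\<Sum>i\<leftarrow>l. u i)))\<^sup>2)
      \<partial>measure_pmf (replicate_pmf b (pmf_of_set {1..n}))) \<partial>measure_pmf (pmf_of_set {1..n}))"
    by (simp add: add.assoc)
  also have "\<dots> \<le> (\<integral>\<^sup>+i. ennreal ((norm (a + u i + real b *\<^sub>R m))\<^sup>2 + real b * V)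
      \<partial>measure_pmf (pmf_of_set {1..n}))"
    by (intro nn_integral_mono Suc.IH)
  also have "\<dots> = (\<Sum>i=1..n. ennreal ((norm (a + u i + real b *\<^sub>R m))\<^sup>2 + real b * V)) / real n"
    using assms(1) by (subst nn_integral_pmf_of_set) (auto simp: ennreal_of_nat_eq_real_of_nat)
  also have "\<dots> = ennreal ((\<Sum>i=1..n. (norm (e + u i))\<^sup>2 + real b * V) / real n)"
  proof -
    have "a + u i + real b *\<^sub>R m = e + u i" for i
      unfolding e_def by (simp only: ac_simps)
    then show ?thesis
      using assms(1) V by (simp only: sum_ennreal) (simp add: divide_ennreal sum_nonneg del: ennreal_plus)
  qed
  also have "\<dots> \<le> ennreal ((norm (a + real (Suc b) *\<^sub>R m))\<^sup>2 + real (Suc b) * V)"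
  proof (rule ennreal_leI)
    have "(\<Sum>i=1..n. (norm (e + u i))\<^sup>2 + real b * V)
      = (\<Sum>i=1..n. (norm e)\<^sup>2 + 2 * inner e (u i) + (norm (u i))\<^sup>2 + real b * V)"
      by (intro sum.cong) (simp_all add: power2_norm_eq_inner algebra_simps inner_commute)
    also have "\<dots> = real n * ((norm e)\<^sup>2 + 2 * inner e m + V + real b * V)"
      by (simp only: sum.distrib sum_u flip: sum_distrib_left inner_sum_right) (simp add: algebra_simps)
    finally have "(\<Sum>i=1..n. (norm (e + u i))\<^sup>2 + real b * V) / real n
      = (norm e)\<^sup>2 + 2 * inner e m + V + real b * V"
      using assms(1) by simp
    also have "\<dots> \<le> (norm (e + m))\<^sup>2 + V + real b * V"
    proof -
      have "(norm (e + m))\<^sup>2 = (norm e)\<^sup>2 + 2 * inner e m + (norm m)\<^sup>2"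
        using dot_norm[of e m] by (simp add: field_simps)
      then show ?thesis by simp
    qed
    also have "e + m = a + real (Suc b) *\<^sub>R m"
      by (simp add: e_def scaleR_add_left)
    finally show "(\<Sum>i=1..n. (norm (e + u i))\<^sup>2 + real b * V) / real n
      \<le> (norm (a + real (Suc b) *\<^sub>R m))\<^sup>2 + real (Suc b) * V"
      by (simp add: distrib_right)
  qed
  finally show ?case .
qed

section \<open>The history of the draws\<close>

text \<open>The history of length \<open>k\<close> is the list of the draws before step \<open>k\<close>.  For draws in a countable
  type it is a discrete random variable, and it generates the past of step \<open>k\<close>.\<close>

definition history :: "(nat \<Rightarrow> 'w \<Rightarrow> 'b) \<Rightarrow> nat \<Rightarrow> 'w \<Rightarrow> 'b list" where
  "history Z k \<omega> = map (\<lambda>j. Z j \<omega>) [0..<k]"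

lemma history_eq_iff: "history Z k \<omega> = history Z k \<omega>' \<longleftrightarrow> (\<forall>j<k. Z j \<omega> = Z j \<omega>')"
  by (auto simp: history_def)

lemma past_generators:
  "(\<Union>j<k. sets (vimage_algebra (space M) (Z j) (count_space UNIV))) \<subseteq> Pow (space M)"
proof (rule UN_least)
  show "sets (vimage_algebra (space M) (Z j) (count_space UNIV)) \<subseteq> Pow (space M)" for j
    using sets.space_closed[of "vimage_algebra (space M) (Z j) (count_space UNIV)"] by simp
qed

lemma space_past [simp]: "space (past M Z k) = space M"
  unfolding past_def by (rule space_measure_of[OF past_generators])

lemma sets_past:
  "sets (past M Z k)
    = sigma_sets (space M) (\<Union>j<k. sets (vimage_algebra (space M) (Z j) (count_space UNIV)))"
  unfolding past_def by (rule sets_measure_of[OF past_generators])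

text \<open>Sets and functions measurable with respect to the past cannot separate two outcomes with the same
  history.\<close>

lemma past_set_determined:
  assumes "A \<in> sets (past M Z k)" and "\<omega> \<in> space M" "\<omega>' \<in> space M"
    and "history Z k \<omega> = history Z k \<omega>'"
  shows "\<omega> \<in> A \<longleftrightarrow> \<omega>' \<in> A"
  using assms(1) unfolding sets_past
proof induction
  case (Basic A)
  then obtain j B where "j < k" "A = Z j -` B \<inter> space M"
    by (auto simp: sets_vimage_algebra2)
  then show ?case
    using assms(2-4) by (auto simp: history_eq_iff)
qed (use assms in auto)

lemma past_measurable_determined:
  fixes h :: "'w \<Rightarrow> 'a::t1_space"
  assumes "h \<in> borel_measurable (past M Z k)" and "\<omega> \<in> space M" "\<omega>' \<in> space M"
    and "history Z k \<omega> = history Z k \<omega>'"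
  shows "h \<omega> = h \<omega>'"
proof -
  have "h -` {h \<omega>} \<inter> space M \<in> sets (past M Z k)"
    using measurable_sets[OF assms(1), of "{h \<omega>}"] by simp
  from past_set_determined[OF this assms(2-4)] show ?thesis
    using assms(2,3) by auto
qed

lemma history_measurable_past:
  fixes Z :: "nat \<Rightarrow> 'w \<Rightarrow> 'b::countable"
  shows "history Z k \<in> measurable (past M Z k) (count_space UNIV)"
  unfolding measurable_count_space_eq2_countable
proof (intro conjI ballI)
  fix h :: "'b list"
  have Z: "{\<omega>\<in>space (past M Z k). Z j \<omega> = z} \<in> sets (past M Z k)" if "j < k" for j z
  proof -
    have "Z j -` {z} \<inter> space M \<in> sets (vimage_algebra (space M) (Z j) (count_space UNIV))"
      by (rule in_vimage_algebra) simp
    then have "Z j -` {z} \<inter> space M \<in> sets (past M Z k)"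
      using that unfolding sets_past by (intro sigma_sets.Basic) blast
    also have "Z j -` {z} \<inter> space M = {\<omega>\<in>space (past M Z k). Z j \<omega> = z}"
      by auto
    finally show ?thesis .
  qed
  have hist: "history Z k \<omega> = h \<longleftrightarrow> length h = k \<and> (\<forall>j\<in>{..<k}. Z j \<omega> = h ! j)" for \<omega>
    unfolding history_def list_eq_iff_nth_eq by auto
  have "{\<omega>\<in>space (past M Z k). \<forall>j\<in>{..<k}. Z j \<omega> = h ! j} \<in> sets (past M Z k)"
    using Z by (intro sets.sets_Collect_finite_All) auto
  moreover have "history Z k -` {h} \<inter> space (past M Z k)
    = (if length h = k then {\<omega>\<in>space (past M Z k). \<forall>j\<in>{..<k}. Z j \<omega> = h ! j} else {})"
    using hist by auto
  ultimately show "history Z k -` {h} \<inter> space (past M Z k) \<in> sets (past M Z k)"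
    by simp
qed simp

lemma sets_past_subset:
  assumes "\<And>j. j < k \<Longrightarrow> Z j \<in> measurable M (count_space UNIV)"
  shows "sets (past M Z k) \<subseteq> sets M"
  unfolding sets_past
proof (rule sets.sigma_sets_subset, rule UN_least)
  fix j assume "j \<in> {..<k}"
  then show "sets (vimage_algebra (space M) (Z j) (count_space UNIV)) \<subseteq> sets M"
    using measurable_sets[OF assms] by (auto simp: sets_vimage_algebra2)
qed

lemma history_measurable:
  fixes Z :: "nat \<Rightarrow> 'w \<Rightarrow> 'b::countable"
  assumes "\<And>j. j < k \<Longrightarrow> Z j \<in> measurable M (count_space UNIV)"
  shows "history Z k \<in> measurable M (count_space UNIV)"
proof (rule measurableI)
  fix A :: "'b list set"
  have "sets (past M Z k) \<subseteq> sets M"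
    by (rule sets_past_subset) (rule assms)
  moreover have "history Z k -` A \<inter> space M \<in> sets (past M Z k)"
    using measurable_sets[OF history_measurable_past, of A Z k M] by simp
  ultimately show "history Z k -` A \<inter> space M \<in> sets M"
    by (rule subsetD)
qed simp

lemma factor_through:
  assumes "\<And>\<omega> \<omega>'. \<omega> \<in> A \<Longrightarrow> \<omega>' \<in> A \<Longrightarrow> H \<omega> = H \<omega>' \<Longrightarrow> h \<omega> = h \<omega>'"
  shows "\<exists>\<phi>. \<forall>\<omega>\<in>A. h \<omega> = \<phi> (H \<omega>)"
proof (intro exI ballI)
  fix \<omega> assume "\<omega> \<in> A"
  then have "inv_into A H (H \<omega>) \<in> A" "H (inv_into A H (H \<omega>)) = H \<omega>"
    by (auto intro: inv_into_into f_inv_into_f)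
  then show "h \<omega> = (h \<circ> inv_into A H) (H \<omega>)"
    using \<open>\<omega> \<in> A\<close> unfolding o_apply by (intro assms) simp_all
qed

lemma determined_borel_measurable:
  assumes "H \<in> measurable M (count_space UNIV)"
    and "\<And>\<omega> \<omega>'. \<omega> \<in> space M \<Longrightarrow> \<omega>' \<in> space M \<Longrightarrow> H \<omega> = H \<omega>' \<Longrightarrow> h \<omega> = h \<omega>'"
  shows "h \<in> borel_measurable M"
proof -
  from factor_through[OF assms(2)] obtain \<phi> where "\<forall>\<omega>\<in>space M. h \<omega> = \<phi> (H \<omega>)" ..
  note \<phi> = bspec[OF this]
  have "(\<lambda>\<omega>. \<phi> (H \<omega>)) \<in> borel_measurable M"
    by (intro measurable_compose[OF assms(1)]) simp
  then show ?thesis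
    using \<phi> by (simp cong: measurable_cong)
qed

text \<open>The tower property for independent discrete variables: integrate out \<open>Z\<close> with \<open>H\<close> held fixed.\<close>

lemma (in prob_space) nn_integral_indep_discrete:
  fixes H :: "'a \<Rightarrow> 'h::countable" and Z :: "'a \<Rightarrow> 'z::countable" and \<Phi> :: "'h \<Rightarrow> 'z \<Rightarrow> ennreal"
  assumes [measurable]: "H \<in> measurable M (count_space UNIV)" "Z \<in> measurable M (count_space UNIV)"
    and indep: "indep_set (sets (vimage_algebra (space M) H (count_space UNIV)))
      (sets (vimage_algebra (space M) Z (count_space UNIV)))"
  shows "(\<integral>\<^sup>+\<omega>. \<Phi> (H \<omega>) (Z \<omega>) \<partial>M)
    = (\<integral>\<^sup>+\<omega>. (\<integral>\<^sup>+z. \<Phi> (H \<omega>) z \<partial>distr M (count_space UNIV) Z) \<partial>M)"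
proof -
  interpret PH: prob_space "distr M (count_space UNIV) H"
    by (rule prob_space_distr) simp
  interpret PZ: prob_space "distr M (count_space UNIV) Z"
    by (rule prob_space_distr) simp
  have prod: "distr M (count_space UNIV) H \<Otimes>\<^sub>M distr M (count_space UNIV) Z
      = distr M (count_space UNIV \<Otimes>\<^sub>M count_space UNIV) (\<lambda>\<omega>. (H \<omega>, Z \<omega>))"
  proof (rule pair_measure_eqI)
    fix A B
    have "prob ((H -` A \<inter> space M) \<inter> (Z -` B \<inter> space M))
        = prob (H -` A \<inter> space M) * prob (Z -` B \<inter> space M)"
      by (rule indep_setD[OF indep]; rule in_vimage_algebra) simp_all
    moreover have "(\<lambda>\<omega>. (H \<omega>, Z \<omega>)) -` (A \<times> B) \<inter> space M
        = (H -` A \<inter> space M) \<inter> (Z -` B \<inter> space M)"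
      by auto
    ultimately show "emeasure (distr M (count_space UNIV) H) A * emeasure (distr M (count_space UNIV) Z) B
        = emeasure (distr M (count_space UNIV \<Otimes>\<^sub>M count_space UNIV) (\<lambda>\<omega>. (H \<omega>, Z \<omega>))) (A \<times> B)"
      by (simp add: emeasure_distr pair_measure_countable emeasure_eq_measure ennreal_mult)
  qed (auto intro!: PH.sigma_finite_measure_axioms PZ.sigma_finite_measure_axioms
        sets_pair_measure_cong)
  have \<Phi>: "case_prod \<Phi> \<in> borel_measurable (count_space UNIV \<Otimes>\<^sub>M count_space UNIV)"
    by (simp add: pair_measure_countable)
  then have \<Phi>': "case_prod \<Phi>
      \<in> borel_measurable (distr M (count_space UNIV) H \<Otimes>\<^sub>M distr M (count_space UNIV) Z)"
    by (simp cong: measurable_cong_sets)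
  have "(\<integral>\<^sup>+\<omega>. \<Phi> (H \<omega>) (Z \<omega>) \<partial>M) = (\<integral>\<^sup>+q. case_prod \<Phi> q
      \<partial>distr M (count_space UNIV \<Otimes>\<^sub>M count_space UNIV) (\<lambda>\<omega>. (H \<omega>, Z \<omega>)))"
    using \<Phi> by (subst nn_integral_distr) auto
  also have "\<dots> = (\<integral>\<^sup>+h. (\<integral>\<^sup>+z. \<Phi> h z \<partial>distr M (count_space UNIV) Z)
      \<partial>distr M (count_space UNIV) H)"
    unfolding prod[symmetric] by (subst PZ.nn_integral_fst[OF \<Phi>', symmetric]) simp
  also have "\<dots> = (\<integral>\<^sup>+\<omega>. (\<integral>\<^sup>+z. \<Phi> (H \<omega>) z \<partial>distr M (count_space UNIV) Z) \<partial>M)"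
    by (subst nn_integral_distr) auto
  finally show ?thesis .
qed

text \<open>The Cauchy-Schwarz inequality, in the form that needs no integrability beforehand.\<close>

lemma (in prob_space) expectation_le_of_second_moment:
  fixes h :: "'a \<Rightarrow> real"
  assumes [measurable]: "h \<in> borel_measurable M" and "\<And>\<omega>. 0 \<le> h \<omega>" and "0 \<le> r"
    and "(\<integral>\<^sup>+\<omega>. ennreal ((h \<omega>)\<^sup>2) \<partial>M) \<le> ennreal (r\<^sup>2)"
  shows "integrable M h" and "expectation h \<le> r"
proof -
  have "(\<integral>\<^sup>+\<omega>. ennreal (h \<omega>) * 1 \<partial>M)\<^sup>2
      \<le> (\<integral>\<^sup>+\<omega>. (ennreal (h \<omega>))\<^sup>2 \<partial>M) * (\<integral>\<^sup>+\<omega>. 1\<^sup>2 \<partial>M)"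
    by (rule Cauchy_Schwarz_nn_integral) auto
  also have "\<dots> \<le> (ennreal r)\<^sup>2"
    using assms by (simp add: emeasure_space_1 ennreal_power)
  finally have sq: "(\<integral>\<^sup>+\<omega>. ennreal (h \<omega>) \<partial>M)\<^sup>2 \<le> (ennreal r)\<^sup>2"
    by simp
  have le: "(\<integral>\<^sup>+\<omega>. ennreal (h \<omega>) \<partial>M) \<le> ennreal r"
  proof (cases "\<integral>\<^sup>+\<omega>. ennreal (h \<omega>) \<partial>M")
    case (real q)
    then show ?thesis
      using sq assms(3) by (simp add: ennreal_power power2_le_iff_abs_le)
  next
    case top
    then show ?thesis
      using sq assms(3) by (simp add: top_power_ennreal ennreal_power top_unique)
  qed
  then have "(\<integral>\<^sup>+\<omega>. ennreal (h \<omega>) \<partial>M) < \<infinity>"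
    using le_less_trans ennreal_less_top by (metis infinity_ennreal_def)
  then show int: "integrable M h"
    using assms(2) by (intro integrableI_nonneg) auto
  show "expectation h \<le> r"
    using le assms(2,3) by (simp add: nn_integral_eq_integral[OF int])
qed

section \<open>The run as a function of the history\<close>

context sarah_frank_wolfe
begin

text \<open>The randomness of step \<open>k\<close>, a batch together with a coin.  It has a countable type, so the state
  of the run is a function of a discrete history and its measurability is automatic.\<close>

abbreviation draw :: "nat \<Rightarrow> 'w \<Rightarrow> nat list \<times> bool" where
  "draw k \<omega> \<equiv> (S k \<omega>, c k \<omega>)"

lemma s_in: "k < K \<Longrightarrow> \<omega> \<in> space M \<Longrightarrow> s k \<omega> \<in> X"
  using s_argmin unfolding is_arg_min_def by blast

lemma x_in:
  assumes "convex X" and \<eta>: "\<And>k. k < K \<Longrightarrow> 0 \<le> \<eta> k" "\<And>k. k < K \<Longrightarrow> \<eta> k \<le> 1"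
    and "k \<le> K" and \<omega>: "\<omega> \<in> space M"
  shows "x k \<omega> \<in> X"
  using \<open>k \<le> K\<close>
proof (induction k)
  case 0
  show ?case using x_init[OF \<omega>] init_in by simp
next
  case (Suc k)
  then have k: "k < K" and IH: "x k \<omega> \<in> X" by auto
  have "x (Suc k) \<omega> = (1 - \<eta> k) *\<^sub>R x k \<omega> + \<eta> k *\<^sub>R s k \<omega>"
    by (simp add: x_step[OF k \<omega>] algebra_simps)
  also have "\<dots> \<in> X"
    by (rule convexD_alt[OF \<open>convex X\<close> IH s_in[OF k \<omega>] \<eta>(1)[OF k] \<eta>(2)[OF k]])
  finally show ?case .
qed

lemma s_determined:
  assumes "k < K" "\<omega> \<in> space M" "\<omega>' \<in> space M" "history draw k \<omega> = history draw k \<omega>'"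
  shows "s k \<omega> = s k \<omega>'"
  using past_measurable_determined[OF s_measurable[OF assms(1)] assms(2-4)] .

lemma x_g_determined:
  assumes "k \<le> K" and \<omega>: "\<omega> \<in> space M" "\<omega>' \<in> space M" and "history draw k \<omega> = history draw k \<omega>'"
  shows "x k \<omega> = x k \<omega>' \<and> g k \<omega> = g k \<omega>'"
  using assms(1,4)
proof (induction k)
  case 0
  show ?case using \<omega> by (simp add: x_init g_init)
next
  case (Suc k)
  then have k: "k < K" and h: "history draw k \<omega> = history draw k \<omega>'"
    and d: "S k \<omega> = S k \<omega>'" "c k \<omega> = c k \<omega>'"
    by (auto simp: history_eq_iff)
  have IH: "x k \<omega> = x k \<omega>'" "g k \<omega> = g k \<omega>'"
    using Suc.IH k h by auto
  have "x (Suc k) \<omega> = x (Suc k) \<omega>'"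
    by (simp only: x_step[OF k \<omega>(1)] x_step[OF k \<omega>(2)] IH s_determined[OF k \<omega> h])
  then show ?case
    by (simp only: g_step[OF k \<omega>(1)] g_step[OF k \<omega>(2)] IH d simp_thms)
qed

lemmas x_determined = x_g_determined[THEN conjunct1]
lemmas g_determined = x_g_determined[THEN conjunct2]

lemma history_draw_measurable:
  assumes "k \<le> K"
  shows "history draw k \<in> measurable M (count_space UNIV)"
proof (rule history_measurable)
  show "draw j \<in> measurable M (count_space UNIV)" if "j < k" for j
    using draw_measurable that assms by simp
qed

text \<open>The function \<open>h\<close> is arbitrary, not necessarily Borel, because the state is discrete.\<close>

lemma measurable_x_g:
  assumes "k \<le> K"
  shows "(\<lambda>\<omega>. h (x k \<omega>) (g k \<omega>)) \<in> borel_measurable M"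
  by (rule determined_borel_measurable[OF history_draw_measurable[OF assms]],
      rule arg_cong2[OF x_determined[OF assms] g_determined[OF assms]])

lemma indep_history_draw:
  assumes "k < K"
  shows "indep_set (sets (vimage_algebra (space M) (history draw k) (count_space UNIV)))
    (sets (vimage_algebra (space M) (draw k) (count_space UNIV)))" (is "indep_set ?H ?Z")
proof (rule indep_setI)
  show "?H \<subseteq> events"
    using measurable_sets[OF history_draw_measurable[OF less_imp_le[OF assms]]]
    by (auto simp: sets_vimage_algebra2)
  show "?Z \<subseteq> events"
    using measurable_sets[OF draw_measurable[OF assms]] by (auto simp: sets_vimage_algebra2)
  fix A B assume "A \<in> ?H" and "B \<in> ?Z"
  from \<open>A \<in> ?H\<close> obtain A' where "A = history draw k -` A' \<inter> space M"
    by (auto simp: sets_vimage_algebra2)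
  then have "A \<in> sets (past M draw k)"
    using measurable_sets[OF history_measurable_past, of A' draw k M] by simp
  from indep_setD[OF draw_indep_past[OF assms] this \<open>B \<in> ?Z\<close>]
  show "prob (A \<inter> B) = prob A * prob B" .
qed

section \<open>The variance of the gradient estimator\<close>

text \<open>The error of the estimator contracts by the factor \<open>1 - p\<close> in mean square, up to the variance of
  one batch of gradient increments, which is small because one step moves by at most \<open>\<eta> k * D\<close>.\<close>

lemma estimator_error_step:
  fixes Li :: "nat \<Rightarrow> real" and D :: real
  defines "e \<equiv> \<lambda>k \<omega>. norm (g k \<omega> - grad (average n f) (x k \<omega>))"
  assumes "convex X" and \<eta>: "\<And>k. k < K \<Longrightarrow> 0 \<le> \<eta> k" "\<And>k. k < K \<Longrightarrow> \<eta> k \<le> 1"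
    and p: "0 \<le> p" "p \<le> 1" and "1 \<le> b" "1 \<le> n"
    and diam: "\<And>u v. u \<in> X \<Longrightarrow> v \<in> X \<Longrightarrow> norm (u - v) \<le> D"
    and grad_avg: "\<And>y. y \<in> X \<Longrightarrow>
      grad (average n f) y = (1 / real n) *\<^sub>R (\<Sum>i=1..n. grad (f i) y)"
    and smooth: "\<And>i. i \<in> {1..n} \<Longrightarrow> smooth_on (Li i) (f i) X"
    and k: "k < K"
  shows "(\<integral>\<^sup>+\<omega>. ennreal ((e (Suc k) \<omega>)\<^sup>2) \<partial>M)
    \<le> ennreal (1 - p) * ((\<integral>\<^sup>+\<omega>. ennreal ((e k \<omega>)\<^sup>2) \<partial>M)
        + ennreal ((\<eta> k * D)\<^sup>2 * ((1 / real n) * (\<Sum>i=1..n. (Li i)\<^sup>2)) / real b))"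
proof -
  let ?H = "history draw k" and ?F = "average n f"
  define C where "C = (\<eta> k * D)\<^sup>2 * ((1 / real n) * (\<Sum>i=1..n. (Li i)\<^sup>2)) / real b"
  have C: "C \<ge> 0" by (simp add: C_def sum_nonneg)
  have k': "k \<le> K" using k by simp
  \<comment> \<open>The current state and the next point, but not the next estimator, are functions of the history.\<close>
  from factor_through[OF x_determined[OF k']]
  obtain x' where "\<forall>\<omega>\<in>space M. x k \<omega> = x' (?H \<omega>)" ..
  note x' = bspec[OF this]
  from factor_through[OF g_determined[OF k']]
  obtain g' where "\<forall>\<omega>\<in>space M. g k \<omega> = g' (?H \<omega>)" ..
  note g' = bspec[OF this]
  from factor_through[OF s_determined[OF k]]
  obtain s' where "\<forall>\<omega>\<in>space M. s k \<omega> = s' (?H \<omega>)" ..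
  note s' = bspec[OF this]
  define y' where "y' h = x' h + \<eta> k *\<^sub>R (s' h - x' h)" for h
  have y': "x (Suc k) \<omega> = y' (?H \<omega>)" if "\<omega> \<in> space M" for \<omega>
    by (simp only: x_step[OF k that] x'[OF that] s'[OF that] y'_def)
  define u where "u h i = (1 / real b) *\<^sub>R (grad (f i) (y' h) - grad (f i) (x' h))" for h i
  \<comment> \<open>The squared error after step \<open>k\<close> for history \<open>h\<close> and draw \<open>z\<close>; it vanishes when the coin
    selects the full gradient.\<close>
  define \<Phi> where "\<Phi> h z = (if snd z then 0
      else ennreal ((norm (g' h - grad ?F (y' h) + (\<Sum>i\<leftarrow>fst z. u h i)))\<^sup>2))"
    for h :: "(nat list \<times> bool) list" and z :: "nat list \<times> bool"
  have e_Suc: "ennreal ((e (Suc k) \<omega>)\<^sup>2) = \<Phi> (?H \<omega>) (draw k \<omega>)" if "\<omega> \<in> space M" for \<omega>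
  proof -
    have "(\<Sum>i\<leftarrow>l. u h i) = (1 / real b) *\<^sub>R (\<Sum>i\<leftarrow>l. grad (f i) (y' h) - grad (f i) (x' h))" for l h
      by (induction l) (simp_all add: u_def scaleR_add_right)
    then show ?thesis
      unfolding e_def g_step[OF k that] y'[OF that] x'[OF that] g'[OF that] \<Phi>_def
      by (simp add: algebra_simps)
  qed
  have inner_le: "(\<integral>\<^sup>+z. \<Phi> (?H \<omega>) z \<partial>distr M (count_space UNIV) (draw k))
      \<le> ennreal (1 - p) * (ennreal ((e k \<omega>)\<^sup>2) + ennreal C)" if \<omega>: "\<omega> \<in> space M" for \<omega>
  proof -
    let ?h = "?H \<omega>"
    define m where "m = (1 / real n) *\<^sub>R (\<Sum>i=1..n. u ?h i)"
    define V where "V = (1 / real n) * (\<Sum>i=1..n. (norm (u ?h i))\<^sup>2)"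
    have xX: "x' ?h \<in> X"
      using x_in[OF \<open>convex X\<close> \<eta> k' \<omega>] by (simp only: x'[OF \<omega>])
    have yX: "y' ?h \<in> X"
      using x_in[OF \<open>convex X\<close> \<eta> Suc_leI[OF k] \<omega>] by (simp only: y'[OF \<omega>])
    \<comment> \<open>The batch sum is unbiased: in the mean it moves the estimator exactly as the gradient of the
      average moves, so the current error reappears.\<close>
    have "real b *\<^sub>R m = grad ?F (y' ?h) - grad ?F (x' ?h)"
      using \<open>1 \<le> b\<close> unfolding m_def u_def grad_avg[OF xX] grad_avg[OF yX]
      by (simp add: sum_subtractf scaleR_diff_right flip: scaleR_sum_right)
    then have mean: "g' ?h - grad ?F (y' ?h) + real b *\<^sub>R m = g k \<omega> - grad ?F (x k \<omega>)"
      by (simp add: x'[OF \<omega>] g'[OF \<omega>])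
    have "norm (y' ?h - x' ?h) = \<eta> k * norm (s k \<omega> - x k \<omega>)"
      using \<eta>(1)[OF k] by (simp add: y'_def x'[OF \<omega>] s'[OF \<omega>])
    also have "\<dots> \<le> \<eta> k * D"
      using diam[OF s_in[OF k \<omega>] x_in[OF \<open>convex X\<close> \<eta> k' \<omega>]] \<eta>(1)[OF k]
      by (rule mult_left_mono)
    finally have move: "norm (y' ?h - x' ?h) \<le> \<eta> k * D" .
    have u_le: "(norm (u ?h i))\<^sup>2 \<le> (1 / real b)\<^sup>2 * (\<eta> k * D)\<^sup>2 * (Li i)\<^sup>2"
      if i: "i \<in> {1..n}" for i
    proof -
      have "norm (grad (f i) (y' ?h) - grad (f i) (x' ?h)) \<le> Li i * norm (y' ?h - x' ?h)"
        using smooth[OF i] xX yX by (auto simp: smooth_on_def)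
      also have "\<dots> \<le> Li i * (\<eta> k * D)"
        using smooth[OF i] move by (intro mult_left_mono) (auto simp: smooth_on_def)
      finally have "(norm (grad (f i) (y' ?h) - grad (f i) (x' ?h)))\<^sup>2 \<le> (Li i * (\<eta> k * D))\<^sup>2"
        by (intro power_mono) auto
      then have "(1 / real b)\<^sup>2 * (norm (grad (f i) (y' ?h) - grad (f i) (x' ?h)))\<^sup>2
          \<le> (1 / real b)\<^sup>2 * (Li i * (\<eta> k * D))\<^sup>2"
        by (rule mult_left_mono) simp
      then show ?thesis
        by (simp only: u_def norm_scaleR power_mult_distrib power2_abs mult_ac)
    qed
    have "real b * V \<le> real b * ((1 / real n) *
        (\<Sum>i=1..n. (1 / real b)\<^sup>2 * (\<eta> k * D)\<^sup>2 * (Li i)\<^sup>2))"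
      unfolding V_def by (intro mult_left_mono sum_mono u_le) auto
    also have "\<dots> = C"
      using \<open>1 \<le> b\<close> unfolding C_def sum_distrib_left[symmetric]
      by (simp add: power2_eq_square)
    finally have bV: "real b * V \<le> C" .
    have "(\<integral>\<^sup>+z. \<Phi> ?h z \<partial>distr M (count_space UNIV) (draw k))
      = (\<integral>\<^sup>+l. ennreal ((norm (g' ?h - grad ?F (y' ?h) + (\<Sum>i\<leftarrow>l. u ?h i)))\<^sup>2) * ennreal (1 - p)
          \<partial>measure_pmf (replicate_pmf b (pmf_of_set {1..n})))"
      unfolding draw_distr[OF k] nn_integral_pair_pmf' using p by (simp add: \<Phi>_def)
    also have "\<dots> = ennreal (1 - p)
        * (\<integral>\<^sup>+l. ennreal ((norm (g' ?h - grad ?F (y' ?h) + (\<Sum>i\<leftarrow>l. u ?h i)))\<^sup>2)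
          \<partial>measure_pmf (replicate_pmf b (pmf_of_set {1..n})))"
      by (subst nn_integral_multc) (simp_all add: mult.commute)
    also have "\<dots> \<le> ennreal (1 - p)
        * ennreal ((norm (g' ?h - grad ?F (y' ?h) + real b *\<^sub>R m))\<^sup>2 + real b * V)"
      unfolding m_def V_def by (intro mult_left_mono nn_integral_batch_le \<open>1 \<le> n\<close>) simp
    also have "\<dots> \<le> ennreal (1 - p) * ennreal ((e k \<omega>)\<^sup>2 + C)"
      unfolding mean e_def using bV by (intro mult_left_mono ennreal_leI) auto
    finally show ?thesis
      using C by simp
  qed
  have [measurable]: "e k \<in> borel_measurable M"
    unfolding e_def by (rule measurable_x_g[OF k'])
  have "(\<integral>\<^sup>+\<omega>. ennreal ((e (Suc k) \<omega>)\<^sup>2) \<partial>M) = (\<integral>\<^sup>+\<omega>. \<Phi> (?H \<omega>) (draw k \<omega>) \<partial>M)"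
    by (intro nn_integral_cong e_Suc)
  also have "\<dots> = (\<integral>\<^sup>+\<omega>. (\<integral>\<^sup>+z. \<Phi> (?H \<omega>) z \<partial>distr M (count_space UNIV) (draw k)) \<partial>M)"
    by (rule nn_integral_indep_discrete[OF history_draw_measurable[OF k'] draw_measurable[OF k]
          indep_history_draw[OF k]])
  also have "\<dots> \<le> (\<integral>\<^sup>+\<omega>. ennreal (1 - p) * (ennreal ((e k \<omega>)\<^sup>2) + ennreal C) \<partial>M)"
    by (intro nn_integral_mono inner_le)
  also have "\<dots> = ennreal (1 - p) * ((\<integral>\<^sup>+\<omega>. ennreal ((e k \<omega>)\<^sup>2) \<partial>M) + ennreal C)"
    by (simp add: nn_integral_cmult nn_integral_add emeasure_space_1)
  finally show ?thesis
    unfolding C_def .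
qed

text \<open>The bound is the fixed point of the recursion \<open>E \<mapsto> (1 - p) * (E + C)\<close>, and the error starts
  at zero.\<close>

lemma estimator_error_bound:
  fixes Li :: "nat \<Rightarrow> real" and D t :: real
  assumes "convex X" and \<eta>: "\<And>k. k < K \<Longrightarrow> \<eta> k = t" and t: "0 \<le> t" "t \<le> 1"
    and p: "0 < p" "p \<le> 1" and "1 \<le> b" "1 \<le> n"
    and diam: "\<And>u v. u \<in> X \<Longrightarrow> v \<in> X \<Longrightarrow> norm (u - v) \<le> D"
    and grad_avg: "\<And>y. y \<in> X \<Longrightarrow>
      grad (average n f) y = (1 / real n) *\<^sub>R (\<Sum>i=1..n. grad (f i) y)"
    and smooth: "\<And>i. i \<in> {1..n} \<Longrightarrow> smooth_on (Li i) (f i) X"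
    and "k \<le> K"
  shows "(\<integral>\<^sup>+\<omega>. ennreal ((norm (g k \<omega> - grad (average n f) (x k \<omega>)))\<^sup>2) \<partial>M)
    \<le> ennreal ((1 - p) / p * ((t * D)\<^sup>2 * ((1 / real n) * (\<Sum>i=1..n. (Li i)\<^sup>2)) / real b))"
  using \<open>k \<le> K\<close>
proof (induction k)
  case 0
  have "(\<integral>\<^sup>+\<omega>. ennreal ((norm (g 0 \<omega> - grad (average n f) (x 0 \<omega>)))\<^sup>2) \<partial>M) = (\<integral>\<^sup>+\<omega>. 0 \<partial>M)"
    by (intro nn_integral_cong) (simp add: x_init g_init)
  then show ?case by simp
next
  case (Suc k)
  define C where "C = (t * D)\<^sup>2 * ((1 / real n) * (\<Sum>i=1..n. (Li i)\<^sup>2)) / real b"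
  have C: "C \<ge> 0" by (simp add: C_def sum_nonneg)
  have k: "k < K" using Suc.prems by simp
  have "(\<integral>\<^sup>+\<omega>. ennreal ((norm (g (Suc k) \<omega> - grad (average n f) (x (Suc k) \<omega>)))\<^sup>2) \<partial>M)
    \<le> ennreal (1 - p) * ((\<integral>\<^sup>+\<omega>. ennreal ((norm (g k \<omega> - grad (average n f) (x k \<omega>)))\<^sup>2) \<partial>M)
        + ennreal C)"
    using estimator_error_step[OF \<open>convex X\<close> _ _ _ _ \<open>1 \<le> b\<close> \<open>1 \<le> n\<close> diam grad_avg smooth k]
      \<eta> t p unfolding C_def \<eta>[OF k] by simp
  also have "\<dots> \<le> ennreal (1 - p) * (ennreal ((1 - p) / p * C) + ennreal C)"
    using Suc.IH Suc.prems unfolding C_def by (intro mult_left_mono add_right_mono) auto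
  also have "\<dots> = ennreal ((1 - p) * ((1 - p) / p * C + C))"
    using p C by (simp add: ennreal_mult)
  also have "(1 - p) * ((1 - p) / p * C + C) = (1 - p) / p * C"
    using p by (simp add: field_simps)
  finally show ?case unfolding C_def .
qed

end

section \<open>Convergence of the Frank-Wolfe gap\<close>

theorem theorem4p3:
  fixes M :: "'w measure"
    and X :: "(real ^ 'd) set"
    and f :: "nat \<Rightarrow> real ^ 'd \<Rightarrow> real"
    and x0 xstar :: "real ^ 'd"
    and n b K :: nat
    and p L D :: real
    and Li :: "nat \<Rightarrow> real"
    and S :: "nat \<Rightarrow> 'w \<Rightarrow> nat list"
    and c :: "nat \<Rightarrow> 'w \<Rightarrow> bool"
    and s x g :: "nat \<Rightarrow> 'w \<Rightarrow> real ^ 'd"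
  defines "F \<equiv> average n f"
    and "Ltilde \<equiv> sqrt ((1 / real n) * (\<Sum>i=1..n. (Li i)\<^sup>2))"
  assumes "X \<noteq> {}" and "convex X" and "compact X"
    and "D > 0" and "\<And>u v. u \<in> X \<Longrightarrow> v \<in> X \<Longrightarrow> norm (u - v) \<le> D"
    and "\<exists>U. open U \<and> X \<subseteq> U \<and> (\<forall>i\<in>{1..n}. f i differentiable_on U)"
    and "smooth_on L F X"
    and "\<And>i. i \<in> {1..n} \<Longrightarrow> smooth_on (Li i) (f i) X"
    and "is_arg_min F (\<lambda>v. v \<in> X) xstar"
    and "0 < p" and "p \<le> 1"
    and "1 \<le> b" and "b \<le> n"
    and "K \<ge> 1"
    and "sarah_frank_wolfe M X n f x0 (\<lambda>k. 1 / sqrt (real K)) p b K S c s x g"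
  shows "integrable M (\<lambda>\<omega>. MIN k\<in>{0..K - 1}. fw_gap F X (x k \<omega>)) \<and>
    (\<integral>\<omega>. (MIN k\<in>{0..K - 1}. fw_gap F X (x k \<omega>)) \<partial>M)
      \<le> abs_const * ((F x0 - F xstar) / sqrt (real K)
          + L * D\<^sup>2 / sqrt (real K) * (1 + Ltilde / L * sqrt ((1 - p) / (p * real b))))"
proof -
  define t where "t = 1 / sqrt (real K)"
  interpret sarah_frank_wolfe M X n f x0 "\<lambda>k. t" p b K S c s x g
    unfolding t_def by fact
  note diam = assms(7) and smooth = \<open>smooth_on L F X\<close>
  have t: "0 \<le> t" "t \<le> 1" and tK: "real K * t = sqrt (real K)" "real K * t\<^sup>2 = 1"
    using \<open>K \<ge> 1\<close> by (auto simp: t_def power_divide real_div_sqrt)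
  have L: "L > 0" using smooth by (simp add: smooth_on_def)
  have n: "1 \<le> n" using \<open>1 \<le> b\<close> \<open>b \<le> n\<close> by simp
  have fi: "GDERIV (f i) y :> grad (f i) y" if "y \<in> X" "i \<in> {1..n}" for i y
  proof -
    obtain U where "open U" "X \<subseteq> U" "f i differentiable_on U"
      using assms(8) \<open>i \<in> {1..n}\<close> by blast
    then have "f i differentiable (at y)"
      using \<open>y \<in> X\<close> differentiable_on_eq_differentiable_at by blast
    then show ?thesis by (rule differentiable_imp_GDERIV_grad)
  qed
  have grad_F: "GDERIV F y :> (1 / real n) *\<^sub>R (\<Sum>i=1..n. grad (f i) y)" if "y \<in> X" for y
    unfolding F_def by (intro GDERIV_average fi that)
  have grad_avg: "grad (average n f) y = (1 / real n) *\<^sub>R (\<Sum>i=1..n. grad (f i) y)"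
    if "y \<in> X" for y
    using grad_eqI[OF grad_F[OF that]] unfolding F_def .
  have F_GDERIV: "GDERIV F y :> grad F y" if "y \<in> X" for y
    using grad_F[OF that] grad_avg[OF that] unfolding F_def by simp
  have xX: "x k \<omega> \<in> X" if "k \<le> K" "\<omega> \<in> space M" for k \<omega>
    using x_in[OF \<open>convex X\<close> _ _ that] t by simp

  define e where "e k \<omega> = norm (g k \<omega> - grad F (x k \<omega>))" for k \<omega>
  \<comment> \<open>The root mean square bound for the estimator at step size \<open>t\<close>.\<close>
  define r where "r = sqrt ((1 - p) / (p * real b)) * Ltilde * t * D"
  have "r \<ge> 0"
    using t \<open>0 < p\<close> \<open>p \<le> 1\<close> \<open>D > 0\<close> by (simp add: r_def Ltilde_def sum_nonneg)
  have "r\<^sup>2 = (1 - p) / p * ((t * D)\<^sup>2 * ((1 / real n) * (\<Sum>i=1..n. (Li i)\<^sup>2)) / real b)"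
    using \<open>0 < p\<close> \<open>p \<le> 1\<close> by (simp add: r_def Ltilde_def power_mult_distrib sum_nonneg ac_simps)
  then have second_moment: "(\<integral>\<^sup>+\<omega>. ennreal ((e k \<omega>)\<^sup>2) \<partial>M) \<le> ennreal (r\<^sup>2)" if "k \<le> K" for k
    using estimator_error_bound[OF \<open>convex X\<close> refl t \<open>0 < p\<close> \<open>p \<le> 1\<close> \<open>1 \<le> b\<close> n diam grad_avg
        assms(10) that] unfolding e_def F_def by simp
  have e_meas: "e k \<in> borel_measurable M" if "k \<le> K" for k
    unfolding e_def[abs_def] by (rule measurable_x_g[OF that])
  have e_nonneg: "0 \<le> e k \<omega>" for k \<omega>
    by (simp add: e_def)
  have e_int: "integrable M (e k)" and e_le: "expectation (e k) \<le> r" if "k \<le> K" for k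
    by (rule expectation_le_of_second_moment[OF e_meas[OF that] e_nonneg \<open>r \<ge> 0\<close>
          second_moment[OF that]])+

  define gap where "gap k \<omega> = fw_gap F X (x k \<omega>)" for k \<omega>
  define mingap where "mingap \<omega> = (MIN k\<in>{0..K - 1}. gap k \<omega>)" for \<omega>
  have mingap_le: "mingap \<omega> \<le> gap k \<omega>" if "k < K" for k \<omega>
    unfolding mingap_def using that by (intro Min_le) auto
  have mingap_in: "\<exists>k<K. mingap \<omega> = gap k \<omega>" for \<omega>
  proof -
    have "mingap \<omega> \<in> (\<lambda>k. gap k \<omega>) ` {0..K - 1}"
      unfolding mingap_def by (intro Min_in) auto
    then show ?thesis using \<open>K \<ge> 1\<close> by force
  qed

  have mingap_meas: "mingap \<in> borel_measurable M"
  proof -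
    have "gap k \<in> borel_measurable M" if "k \<le> K" for k
      unfolding gap_def[abs_def] by (rule measurable_x_g[OF that])
    then show ?thesis
      unfolding mingap_def[abs_def] using \<open>K \<ge> 1\<close> by (intro borel_measurable_Min) auto
  qed
  \<comment> \<open>The gap is bounded on \<open>X\<close>, since the gradient is Lipschitz and \<open>X\<close> has finite diameter.\<close>
  have mingap_int: "integrable M mingap"
  proof (rule integrable_const_bound[OF _ mingap_meas])
    have "\<bar>mingap \<omega>\<bar> \<le> (norm (grad F x0) + L * D) * D" if \<omega>: "\<omega> \<in> space M" for \<omega>
    proof -
      obtain k where k: "k < K" "mingap \<omega> = gap k \<omega>"
        using mingap_in by blast
      have X: "x k \<omega> \<in> X" using xX k \<omega> by simp
      have "norm (grad F (x k \<omega>)) \<le> norm (grad F x0) + norm (grad F (x k \<omega>) - grad F x0)"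
        by (rule norm_triangle_sub)
      also have "norm (grad F (x k \<omega>) - grad F x0) \<le> L * norm (x k \<omega> - x0)"
        using smooth X init_in by (simp add: smooth_on_def)
      also have "\<dots> \<le> L * D"
        using L diam[OF X init_in] by simp
      finally have "norm (grad F (x k \<omega>)) * D \<le> (norm (grad F x0) + L * D) * D"
        using \<open>D > 0\<close> by simp
      then show ?thesis
        using fw_gap_bounds[OF diam X, of F] k by (simp add: gap_def)
    qed
    then show "AE \<omega> in M. norm (mingap \<omega>) \<le> (norm (grad F x0) + L * D) * D"
      by (intro AE_I2) simp
  qed

  define A where "A = (F x0 - F xstar + L * D\<^sup>2) / sqrt (real K)"
  have path: "mingap \<omega> \<le> A + D / real K * (\<Sum>k<K. e k \<omega>)" if \<omega>: "\<omega> \<in> space M" for \<omega>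
  proof -
    have step: "t * gap k \<omega> \<le> F (x k \<omega>) - F (x (Suc k) \<omega>) + (t * D * e k \<omega> + L * t\<^sup>2 * D\<^sup>2)"
      if k: "k < K" for k
    proof -
      have "is_arg_min (inner (g k \<omega>)) (\<lambda>v. v \<in> X) (s k \<omega>)"
        using s_argmin[OF k \<omega>] .
      from fw_step[OF \<open>convex X\<close> F_GDERIV smooth diam xX[OF less_imp_le[OF k] \<omega>] this t]
      show ?thesis
        by (simp add: gap_def e_def x_step[OF k \<omega>])
    qed
    have "sqrt (real K) * mingap \<omega> = (\<Sum>k<K. t * mingap \<omega>)"
      by (simp add: tK(1) flip: mult.assoc)
    also have "\<dots> \<le> (\<Sum>k<K. t * gap k \<omega>)"
      using mingap_le t by (intro sum_mono mult_left_mono) auto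
    also have "\<dots> \<le> (\<Sum>k<K. F (x k \<omega>) - F (x (Suc k) \<omega>) + (t * D * e k \<omega> + L * t\<^sup>2 * D\<^sup>2))"
      using step by (intro sum_mono) auto
    also have "\<dots> = F (x 0 \<omega>) - F (x K \<omega>) + t * D * (\<Sum>k<K. e k \<omega>) + real K * t\<^sup>2 * (L * D\<^sup>2)"
      using sum_lessThan_telescope'[of "\<lambda>k. F (x k \<omega>)" K]
      by (simp add: sum.distrib sum_distrib_left)
    also have "\<dots> \<le> F x0 - F xstar + t * D * (\<Sum>k<K. e k \<omega>) + L * D\<^sup>2"
      using assms(11) xX[OF order_refl \<omega>] tK(2) x_init[OF \<omega>]
      by (auto simp: is_arg_min_linorder)
    finally have "mingap \<omega> \<le> (F x0 - F xstar + t * D * (\<Sum>k<K. e k \<omega>) + L * D\<^sup>2) / sqrt (real K)"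
      using \<open>K \<ge> 1\<close> by (simp add: pos_le_divide_eq mult.commute)
    also have "\<dots> = A + (t / sqrt (real K)) * D * (\<Sum>k<K. e k \<omega>)"
      by (simp add: A_def add_divide_distrib)
    also have "t / sqrt (real K) = 1 / real K"
      by (simp add: t_def)
    finally show ?thesis by simp
  qed

  have sum_int: "integrable M (\<lambda>\<omega>. D / real K * (\<Sum>k<K. e k \<omega>))"
    using e_int by (intro integrable_mult_right Bochner_Integration.integrable_sum) auto
  have "expectation mingap \<le> expectation (\<lambda>\<omega>. A + D / real K * (\<Sum>k<K. e k \<omega>))"
    by (rule integral_mono[OF mingap_int
          Bochner_Integration.integrable_add[OF integrable_const sum_int] path])
  also have "\<dots> = A + expectation (\<lambda>\<omega>. D / real K * (\<Sum>k<K. e k \<omega>))"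
    by (subst Bochner_Integration.integral_add[OF integrable_const sum_int]) (simp add: prob_space)
  also have "expectation (\<lambda>\<omega>. D / real K * (\<Sum>k<K. e k \<omega>)) = D / real K * (\<Sum>k<K. expectation (e k))"
    using e_int by (subst integral_mult_right_zero, subst Bochner_Integration.integral_sum) auto
  also have "A + D / real K * (\<Sum>k<K. expectation (e k)) \<le> A + D / real K * (\<Sum>k<K. r)"
    using e_le \<open>D > 0\<close> by (intro add_left_mono mult_left_mono sum_mono) auto
  also have "\<dots> = A + D * r"
    using \<open>K \<ge> 1\<close> by simp
  also have "\<dots> = (F x0 - F xstar) / sqrt (real K)
      + L * D\<^sup>2 / sqrt (real K) * (1 + Ltilde / L * sqrt ((1 - p) / (p * real b)))"
    using L by (simp add: A_def r_def t_def power2_eq_square add_divide_distrib distrib_left)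
  finally show ?thesis
    using mingap_int unfolding mingap_def[abs_def] gap_def abs_const_def by simp
qed

end
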